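(* Let $\mathbb F$ be a field, let $d\geq 1$ be an integer, and consider the vector space $V=\mathbb F^{d+1}$. Assume that $q\in\mathbb F$ is a primitive $n^{\rm th}$ root of unity, where $n=d+1$. Pick $\varepsilon\in\mathbb F$ that is not among $1,q,q^2,\ldots,q^d$. Define a matrix $A\in{\rm Mat}_{d+1}(\mathbb F)$ as follows: $A_{i,i}=q^{-i}\varepsilon$ for $0\le i\le d$; $A_{0,d}=1-\varepsilon$; $A_{i,i-1}=1-q^{-i}\varepsilon$ for $1\le i\le d$; all other entries of $A$ are zero. Define a diagonal matrix $A^*\in{\rm Mat}_{d+1}(\mathbb F)$ with $A^*_{i,i}=q^i$ for $0\le i\le d$. Then the pair $A,A^*$ acts on $V$ as a circular bidiagonal pair. Moreover $$A^n=I,\qquad (A^* )^n=I,\qquad \frac{qAA^*-A^*A}{q-1}=\varepsilon I.$$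
   Context: $\mathbb F^{d+1}$ consists of column vectors, on which ${\rm Mat}_{d+1}(\mathbb F)$ acts by left multiplication; rows, columns and coordinates are indexed by $0,1,\ldots,d$. $I$ is the identity matrix. (Here $A^*$ is just a name for a second matrix.) For $d\ge 1$, a matrix in ${\rm Mat}_{d+1}(\mathbb F)$ is circular bidiagonal whenever (i) each nonzero entry is on the diagonal, or the subdiagonal (entries $(i,i-1)$, $1\le i\le d$), or in the top-right corner (entry $(0,d)$); (ii) each subdiagonal entry is nonzero and the top-right corner entry is nonzero. A circular bidiagonal pair on a $(d+1)$-dimensional vector space $V$ over $\mathbb F$ is an ordered pair of $\mathbb F$-linear maps $A:V\to V$, $A^*:V\to V$ such that (i) there exists a basis for $V$ with respect to which the matrix representing $A$ is circular bidiagonal and the matrix representing $A^*$ is diagonal; (ii) there exists a basis for $V$ with respect to which the matrix representing $A^*$ is circular bidiagonal and the matrix representing $A$ is diagonal. Here a matrix $X$ represents $A$ with respect to a basis $\{v_i\}_{i=0}^d$ whenever $Av_j=\sum_i X_{i,j}v_i$ for all $j$. *)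

theory Defs
  imports "Jordan_Normal_Form.VS_Connect"
begin

definition primitive_root_of_unity :: "nat \<Rightarrow> 'a::field \<Rightarrow> bool" where
  "primitive_root_of_unity n q \<longleftrightarrow> n > 0 \<and> q ^ n = 1 \<and> (\<forall>k. 0 < k \<and> k < n \<longrightarrow> q ^ k \<noteq> 1)"

definition circular_bidiagonal :: "nat \<Rightarrow> 'a::field mat \<Rightarrow> bool" where
  "circular_bidiagonal d X \<longleftrightarrow>
     d \<ge> 1 \<and> X \<in> carrier_mat (d + 1) (d + 1) \<and>
     (\<forall>i\<le>d. \<forall>j\<le>d. X $$ (i, j) \<noteq> 0 \<longrightarrow> i = j \<or> i = j + 1 \<or> (i = 0 \<and> j = d)) \<and>
     (\<forall>i. 1 \<le> i \<and> i \<le> d \<longrightarrow> X $$ (i, i - 1) \<noteq> 0) \<and>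
     X $$ (0, d) \<noteq> 0"

text \<open>A vector space over the field \<open>'a\<close> is a \<open>vectorspace\<close> over \<open>class_ring\<close>, i.e. over \<open>'a\<close>
  regarded as a ring record. Bases are indexed by \<open>0, \<dots>, d\<close>; the injectivity condition is needed
  because the library's notion of basis only concerns the underlying set.\<close>

definition indexed_basis :: "('a::field, 'v) module \<Rightarrow> nat \<Rightarrow> (nat \<Rightarrow> 'v) \<Rightarrow> bool" where
  "indexed_basis V d v \<longleftrightarrow> inj_on v {0..d} \<and> vectorspace.basis class_ring V (v ` {0..d})"

definition represents_wrt ::
  "('a::field, 'v) module \<Rightarrow> nat \<Rightarrow> (nat \<Rightarrow> 'v) \<Rightarrow> 'a mat \<Rightarrow> ('v \<Rightarrow> 'v) \<Rightarrow> bool" where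
  "represents_wrt V d v X T \<longleftrightarrow>
     X \<in> carrier_mat (d + 1) (d + 1) \<and>
     (\<forall>j\<le>d. T (v j) = (\<Oplus>\<^bsub>V\<^esub>i\<in>{0..d}. X $$ (i, j) \<odot>\<^bsub>V\<^esub> v i))"

definition circular_bidiagonal_pair ::
  "('a::field, 'v) module \<Rightarrow> nat \<Rightarrow> ('v \<Rightarrow> 'v) \<Rightarrow> ('v \<Rightarrow> 'v) \<Rightarrow> bool" where
  "circular_bidiagonal_pair V d T Ts \<longleftrightarrow>
     vectorspace (class_ring :: 'a ring) V \<and>
     vectorspace.fin_dim (class_ring :: 'a ring) V \<and>
     vectorspace.dim (class_ring :: 'a ring) V = d + 1 \<and>
     linear_map (class_ring :: 'a ring) V V T \<and>
     linear_map (class_ring :: 'a ring) V V Ts \<and>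
     (\<exists>v X Xs. indexed_basis V d v \<and>
        represents_wrt V d v X T \<and> circular_bidiagonal d X \<and>
        represents_wrt V d v Xs Ts \<and> diagonal_mat Xs) \<and>
     (\<exists>v X Xs. indexed_basis V d v \<and>
        represents_wrt V d v Xs Ts \<and> circular_bidiagonal d Xs \<and>
        represents_wrt V d v X T \<and> diagonal_mat X)"

end

theory Submission
  imports Defs "Jordan_Normal_Form.DL_Rank" "HOL-Computational_Algebra.Polynomial"
begin

text \<open>
  Put \<open>R\<^sub>m(x) = (x - \<epsilon>)(x - q\<epsilon>)\<cdots>(x - q\<^sup>m\<^sup>-\<^sup>1\<epsilon>)\<close> and let \<open>w\<^sub>m\<close> be the vector with
  coordinates \<open>R\<^sub>m(q\<^sup>i)\<close>. The shift identity \<open>(qy - \<epsilon>) q\<^sup>m R\<^sub>m(y) = R\<^sub>m\<^sub>+\<^sub>1(qy)\<close> says that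
  \<open>A w\<^sub>m = q\<^sup>-\<^sup>m w\<^sub>m\<close>, and the recurrence \<open>x R\<^sub>m(x) = R\<^sub>m\<^sub>+\<^sub>1(x) + q\<^sup>m \<epsilon> R\<^sub>m(x)\<close> says that \<open>A\<^sup>*\<close> is
  bidiagonal on the \<open>w\<^sub>m\<close>. It closes up to a cycle because \<open>R\<^sub>n\<close> is a nonzero constant on the powers
  of \<open>q\<close>. The \<open>w\<^sub>m\<close> form a basis since the \<open>R\<^sub>m\<close> with \<open>m < n\<close> have distinct degrees below \<open>n\<close> and
  the \<open>n\<close> points \<open>q\<^sup>i\<close> are distinct.
\<close>

section \<open>Bases and representing matrices in coordinates\<close>

text \<open>A repeated column would force \<open>det W = 0\<close>, which gives the injectivity. The
  columns are independent for the same reason, and their number is the dimension.\<close>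

lemma indexed_basis_col:
  fixes W :: "'a::field mat"
  assumes W: "W \<in> carrier_mat (d + 1) (d + 1)" and det: "det W \<noteq> 0"
  shows "indexed_basis (module_vec TYPE('a) (d + 1)) d (col W)"
proof -
  interpret vec_space "TYPE('a)" "d + 1" .
  have inj: "inj_on (col W) {0..d}"
  proof (rule inj_onI, rule ccontr)
    fix i j assume "i \<in> {0..d}" "j \<in> {0..d}" "col W i = col W j" "i \<noteq> j"
    then show False using det_identical_cols[OF W, of i j] det by simp
  qed
  have cols: "set (cols W) = col W ` {0..d}"
    using W by (simp add: cols_def atLeastLessThanSuc_atLeastAtMost del: upt_Suc)
  have "lin_indpt (set (cols W))"
    using lin_dep_cols_imp_det_0[OF W] det by blast
  then have "basis (set (cols W))"
  proof (intro dim_li_is_basis)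
    show "fin_dim" by (rule fin_dim)
    show "set (cols W) \<subseteq> carrier_vec (d + 1)" using W cols_dim[of W] by simp
    show "dim \<le> card (set (cols W))" unfolding dim_is_n using inj by (simp add: cols card_image)
  qed simp
  then show ?thesis
    using inj by (simp add: indexed_basis_def cols)
qed

text \<open>Column \<open>j\<close> of \<open>B * W = W * X\<close> is the expansion of the image of
  the \<open>j\<close>-th basis vector, so a representing matrix can be checked without inverting
  \<open>W\<close>.\<close>

lemma represents_wrt_col:
  fixes W X B :: "'a::field mat"
  assumes W: "W \<in> carrier_mat (d + 1) (d + 1)" and X: "X \<in> carrier_mat (d + 1) (d + 1)"
    and B: "B \<in> carrier_mat (d + 1) (d + 1)" and eq: "B * W = W * X"
  shows "represents_wrt (module_vec TYPE('a) (d + 1)) d (col W) X (\<lambda>x. B *\<^sub>v x)"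
proof -
  interpret vec_space "TYPE('a)" "d + 1" .
  have "B *\<^sub>v col W j = finsum V (\<lambda>i. X $$ (i, j) \<cdot>\<^sub>v col W i) {0..d}" if j: "j \<le> d" for j
  proof (rule eq_vecI)
    have cl: "(\<lambda>i. X $$ (i, j) \<cdot>\<^sub>v col W i) \<in> {0..d} \<rightarrow> carrier_vec (d + 1)"
      using W by (intro Pi_I smult_carrier_vec[THEN iffD2] col_carrier_vec) auto
    then show dim: "dim_vec (B *\<^sub>v col W j) = dim_vec (finsum V (\<lambda>i. X $$ (i, j) \<cdot>\<^sub>v col W i) {0..d})"
      using B finsum_dim[OF _ cl] by simp
    fix r assume "r < dim_vec (finsum V (\<lambda>i. X $$ (i, j) \<cdot>\<^sub>v col W i) {0..d})"
    then have r: "r < d + 1" using dim B by simp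
    have "(B *\<^sub>v col W j) $ r = (B * W) $$ (r, j)"
      using r j B W by simp
    also have "\<dots> = (\<Sum>i = 0..d. W $$ (r, i) * X $$ (i, j))"
      using r j W X unfolding eq
      by (auto simp: scalar_prod_def atLeastLessThanSuc_atLeastAtMost intro!: sum.cong)
    also have "\<dots> = finsum V (\<lambda>i. X $$ (i, j) \<cdot>\<^sub>v col W i) {0..d} $ r"
      unfolding finsum_vec[symmetric]
      by (subst index_finsum_vec) (use r W cl in \<open>auto intro!: sum.cong\<close>)
    finally show "(B *\<^sub>v col W j) $ r = finsum V (\<lambda>i. X $$ (i, j) \<cdot>\<^sub>v col W i) {0..d} $ r" .
  qed
  then show ?thesis
    using X by (simp add: represents_wrt_def module_vec_simps)
qed

lemma linear_map_mult_mat_vec: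
  fixes B :: "'a::field mat"
  assumes B: "B \<in> carrier_mat n n"
  shows "linear_map (class_ring :: 'a ring) (module_vec TYPE('a) n) (module_vec TYPE('a) n)
    (\<lambda>x. B *\<^sub>v x)"
  unfolding linear_map_def mod_hom_def mod_hom_axioms_def
  using B vec_vs[of n, where ?'a = 'a] vec_module[of n, where ?'a = 'a]
  by (simp add: LinearCombinations.module_hom_def module_vec_simps mult_add_distrib_mat_vec mult_mat_vec)

lemma pow_mat_intertwine:
  fixes B W D :: "'a::field mat"
  assumes B: "B \<in> carrier_mat n n" and W: "W \<in> carrier_mat n n" and D: "D \<in> carrier_mat n n"
    and eq: "B * W = W * D"
  shows "B ^\<^sub>m k * W = W * D ^\<^sub>m k"
proof (induction k)
  case 0
  then show ?case using B W D by auto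
next
  case (Suc k)
  have Bk: "B ^\<^sub>m k \<in> carrier_mat n n" and Dk: "D ^\<^sub>m k \<in> carrier_mat n n"
    using B D by auto
  have "B ^\<^sub>m Suc k * W = B ^\<^sub>m k * (B * W)"
    using assoc_mult_mat[OF Bk B W] by simp
  also have "\<dots> = (B ^\<^sub>m k * W) * D"
    unfolding eq using assoc_mult_mat[OF Bk W D] by simp
  also have "\<dots> = W * D ^\<^sub>m Suc k"
    unfolding Suc.IH using assoc_mult_mat[OF W Dk D] by simp
  finally show ?case .
qed

lemma pow_mat_diag: "mat_diag n f ^\<^sub>m k = mat_diag n (\<lambda>i. f i ^ k)"
proof (induction k)
  case 0
  show ?case by (simp add: mat_diag_def one_mat_def)
next
  case (Suc k)
  then show ?case by (simp add: power_commutes)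
qed

text \<open>With a right inverse \<open>U\<close> of \<open>W\<close>, the power of \<open>B\<close>
  equals \<open>W\<close> times that of \<open>D\<close> times \<open>U\<close>, which collapses to
  \<open>W * U\<close>.\<close>

lemma pow_mat_eq_one_of_intertwine:
  fixes B W D :: "'a::field mat"
  assumes B: "B \<in> carrier_mat n n" and W: "W \<in> carrier_mat n n" and D: "D \<in> carrier_mat n n"
    and eq: "B * W = W * D" and det: "det W \<noteq> 0" and pow: "D ^\<^sub>m k = 1\<^sub>m n"
  shows "B ^\<^sub>m k = 1\<^sub>m n"
proof -
  obtain U where U: "U \<in> carrier_mat n n" and WU: "W * U = 1\<^sub>m n"
    using det_non_zero_imp_unit[OF W det, of "()"]
    unfolding Units_def ring_mat_def by auto
  have Bk: "B ^\<^sub>m k \<in> carrier_mat n n" using B by simp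
  have "B ^\<^sub>m k = B ^\<^sub>m k * W * U"
    using assoc_mult_mat[OF Bk W U] right_mult_one_mat[OF Bk] by (simp add: WU)
  also have "\<dots> = 1\<^sub>m n"
    using pow_mat_intertwine[OF B W D eq] W by (simp add: pow WU)
  finally show ?thesis .
qed

section \<open>Newton polynomials\<close>

lemma degree_prod_linear:
  fixes c :: "nat \<Rightarrow> 'a::idom"
  shows "degree (\<Prod>k<m. [:- c k, 1:]) = m"
  by (subst degree_prod_eq_sum_degree) auto

text \<open>The products have strictly increasing degrees and are monic, so the top coefficient of
  the sum isolates the last \<open>a m\<close>; induction removes the terms one by one.\<close>

lemma newton_coeffs_zero:
  fixes a c :: "nat \<Rightarrow> 'a::idom"
  assumes "(\<Sum>m<n. Polynomial.smult (a m) (\<Prod>k<m. [:- c k, 1:])) = 0" "m < n"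
  shows "a m = 0"
  using assms
proof (induction n)
  case (Suc n)
  have monic: "coeff (\<Prod>k<n. [:- c k, 1:]) n = 1"
    using lead_coeff_prod[of "\<lambda>k. [:- c k, 1:]" "{..<n}"] by (simp add: degree_prod_linear)
  have "coeff (\<Sum>m<n. Polynomial.smult (a m) (\<Prod>k<m. [:- c k, 1:])) n = 0"
    unfolding coeff_sum by (intro sum.neutral) (auto simp: coeff_eq_0 degree_prod_linear)
  then have "a n = coeff (\<Sum>m<Suc n. Polynomial.smult (a m) (\<Prod>k<m. [:- c k, 1:])) n"
    using monic by simp
  then have "a n = 0" using Suc.prems by (simp del: sum.lessThan_Suc)
  then show ?case using Suc by (auto simp: less_Suc_eq)
qed simp

text \<open>The combination is a polynomial of degree below \<open>n\<close> with \<open>n\<close>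
  distinct roots, hence zero. This will make the matrix of values invertible.\<close>

lemma newton_values_independent:
  fixes a c x :: "nat \<Rightarrow> 'a::idom"
  assumes inj: "inj_on x {..<n}"
    and zero: "\<And>i. i < n \<Longrightarrow> (\<Sum>m<n. a m * (\<Prod>k<m. x i - c k)) = 0"
    and m: "m < n"
  shows "a m = 0"
proof -
  define p where "p = (\<Sum>m<n. Polynomial.smult (a m) (\<Prod>k<m. [:- c k, 1:]))"
  have "degree p \<le> n - 1"
    unfolding p_def
    by (intro degree_sum_le) (auto intro!: order.trans[OF degree_smult_le] simp: degree_prod_linear)
  then have deg: "degree p < n" using m by linarith
  have roots: "poly p (x i) = 0" if "i < n" for i
    using zero[OF that] by (simp add: p_def poly_sum poly_prod)
  have "p = 0"
  proof (rule poly_eqI_degree[of "x ` {..<n}"])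
    show "poly p y = poly 0 y" if "y \<in> x ` {..<n}" for y using that roots by auto
  qed (use inj deg m in \<open>auto simp: card_image\<close>)
  then show ?thesis
    using newton_coeffs_zero m unfolding p_def by blast
qed

definition qnewton :: "'a::field \<Rightarrow> 'a \<Rightarrow> nat \<Rightarrow> 'a \<Rightarrow> 'a" where
  "qnewton q e m x = (\<Prod>k<m. x - q ^ k * e)"

lemma qnewton_0 [simp]: "qnewton q e 0 x = 1"
  by (simp add: qnewton_def)

lemma qnewton_Suc: "qnewton q e (Suc m) x = (x - q ^ m * e) * qnewton q e m x"
  by (simp add: qnewton_def mult.commute)

text \<open>Each factor satisfies \<open>q * (y - q ^ k * e) = q * y - q ^ Suc k * e\<close>, so
  scaling by \<open>q ^ m\<close> moves all nodes up by one; the extra factor supplies the missing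
  node \<open>e\<close>.\<close>

lemma qnewton_shift: "(q * y - e) * (q ^ m * qnewton q e m y) = qnewton q e (Suc m) (q * y)"
proof (induction m)
  case 0
  show ?case by (simp add: qnewton_def)
next
  case (Suc m)
  have "(q * y - e) * (q ^ Suc m * qnewton q e (Suc m) y)
      = (q * y - q ^ Suc m * e) * ((q * y - e) * (q ^ m * qnewton q e m y))"
    by (simp add: qnewton_Suc algebra_simps)
  then show ?case unfolding Suc.IH by (simp add: qnewton_Suc)
qed

lemma primitive_root_inj:
  fixes q :: "'a::field"
  assumes "primitive_root_of_unity n q"
  shows "inj_on (\<lambda>i. q ^ i) {..<n}"
proof (rule linorder_inj_onI)
  fix i j assume ij: "i < j" "i \<in> {..<n}" "j \<in> {..<n}"
  have q0: "q \<noteq> 0" using assms by (auto simp: primitive_root_of_unity_def power_0_left)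
  have "q ^ j = q ^ i * q ^ (j - i)" using ij by (simp flip: power_add)
  moreover have "q ^ (j - i) \<noteq> 1" using assms ij by (auto simp: primitive_root_of_unity_def)
  ultimately show "q ^ i \<noteq> q ^ j" using q0 by simp
qed auto

theorem lemma2p6:
  fixes d n :: nat and q \<epsilon> :: "'a::field" and A As :: "'a mat"
  assumes "d \<ge> 1"
    and "n = d + 1"
    and "primitive_root_of_unity n q"
    and "\<epsilon> \<notin> {q ^ i | i. i \<le> d}"
    and "A = mat (d + 1) (d + 1) (\<lambda>(i, j).
           if i = j then q powi (- int i) * \<epsilon>
           else if i = 0 \<and> j = d then 1 - \<epsilon>
           else if i = j + 1 then 1 - q powi (- int i) * \<epsilon>
           else 0)"
    and "As = mat (d + 1) (d + 1) (\<lambda>(i, j). if i = j then q ^ i else 0)"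
  shows "circular_bidiagonal_pair (module_vec TYPE('a) (d + 1)) d
           (\<lambda>x. A *\<^sub>v x) (\<lambda>x. As *\<^sub>v x)
       \<and> A ^\<^sub>m n = 1\<^sub>m (d + 1)
       \<and> As ^\<^sub>m n = 1\<^sub>m (d + 1)
       \<and> (1 / (q - 1)) \<cdot>\<^sub>m (q \<cdot>\<^sub>m (A * As) - As * A) = \<epsilon> \<cdot>\<^sub>m 1\<^sub>m (d + 1)"
proof -
  note d = assms(1) and n = assms(2) and prim = assms(3)
  have qn: "q ^ n = 1" and q0: "q \<noteq> 0" and q1: "q \<noteq> 1"
    using prim d n by (auto simp: primitive_root_of_unity_def power_0_left
        dest: spec[of _ 1])
  \<comment> \<open>The hypothesis covers only exponents up to \<open>d\<close>; periodicity modulo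
    \<open>n\<close> extends it to all of them.\<close>
  have pow_ne: "q ^ i \<noteq> \<epsilon>" for i
  proof -
    have "q ^ i = q ^ (i mod n) * (q ^ n) ^ (i div n)"
      by (simp flip: power_mult power_add)
    then have "q ^ i = q ^ (i mod n)" by (simp add: qn)
    moreover have "i mod n \<le> d" using n mod_less_divisor[of n i] by linarith
    ultimately show ?thesis using assms(4) by fastforce
  qed
  have A: "A \<in> carrier_mat (d + 1) (d + 1)" and As: "As \<in> carrier_mat (d + 1) (d + 1)"
    by (simp_all add: assms(5,6))
  have As_diag: "As = mat_diag (d + 1) (\<lambda>i. q ^ i)"
    by (rule eq_matI) (auto simp: assms(6) mat_diag_def)
  \<comment> \<open>The cyclic predecessor of \<open>i\<close>: with it the corner entry of
    \<open>A\<close> obeys the same formula as the subdiagonal, as \<open>A_ix\<close>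
    records.\<close>
  define p where "p i = (if i = 0 then d else i - 1)" for i
  have q_p: "q * q ^ p i = q ^ i" for i
    using qn n by (cases i) (simp_all add: p_def)
  have A_ix: "A $$ (i, j) = (if j = i then \<epsilon> / q ^ i else 0) + (if j = p i then 1 - \<epsilon> / q ^ i else 0)"
    if "i \<le> d" "j \<le> d" for i j
    using that d by (auto simp: assms(5) p_def power_int_minus field_simps)
  define R where "R = qnewton q \<epsilon>"
  define W where "W = mat (d + 1) (d + 1) (\<lambda>(i, m). R m (q ^ i))"
  define D where "D = mat_diag (d + 1) (\<lambda>m. inverse q ^ m)"
  define c where "c = R n 1"
  \<comment> \<open>The cyclic successor, giving the off-diagonal position in column
    \<open>m\<close> of \<open>Xs\<close>; the corner carries \<open>c\<close>.\<close>
  define s where "s m = (if m = d then 0 else Suc m)" for m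
  define Xs where "Xs = mat (d + 1) (d + 1)
    (\<lambda>(k, m). (if k = m then q ^ m * \<epsilon> else 0) + (if k = s m then (if m = d then c else 1) else 0))"
  have W: "W \<in> carrier_mat (d + 1) (d + 1)" and D: "D \<in> carrier_mat (d + 1) (d + 1)"
    and Xs: "Xs \<in> carrier_mat (d + 1) (d + 1)"
    by (simp_all add: W_def D_def Xs_def)
  \<comment> \<open>For \<open>m = n\<close> both sides of the shift identity contain the factor
    \<open>q ^ Suc i - \<epsilon>\<close>, because \<open>q ^ n = 1\<close>; it is nonzero and
    cancels.\<close>
  have R_n: "R n (q ^ i) = c" for i
  proof (induction i)
    case (Suc i)
    have "(q ^ Suc i - \<epsilon>) * R n (q ^ Suc i) = (q ^ Suc i - \<epsilon>) * R n (q ^ i)"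
      using qnewton_shift[of q "q ^ i" \<epsilon> n] by (auto simp: R_def qnewton_Suc qn)
    then have "R n (q ^ Suc i) = R n (q ^ i)" using pow_ne[of "Suc i"] by simp
    then show ?case using Suc by simp
  qed (simp add: c_def)
  \<comment> \<open>A vanishing factor of \<open>R n 1\<close> would make \<epsilon> equal to
    \<open>q ^ (n - k)\<close>.\<close>
  have c0: "c \<noteq> 0"
  proof
    assume "c = 0"
    then obtain k where k: "k < n" "q ^ k * \<epsilon> = 1"
      by (auto simp: c_def R_def qnewton_def)
    have "q ^ (n - k) = q ^ (n - k) * q ^ k * \<epsilon>" using k by simp
    also have "\<dots> = \<epsilon>" using k(1) qn by (simp flip: power_add)
    finally show False using pow_ne by blast
  qed
  have det: "det W \<noteq> 0"
  proof
    assume "det W = 0"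
    then obtain v where v: "v \<in> carrier_vec (d + 1)" "v \<noteq> 0\<^sub>v (d + 1)" "W *\<^sub>v v = 0\<^sub>v (d + 1)"
      using det_0_iff_vec_prod_zero_field[OF W] by blast
    have "(\<Sum>m<n. v $ m * (\<Prod>k<m. q ^ i - q ^ k * \<epsilon>)) = 0" if i: "i < n" for i
    proof -
      have "(\<Sum>m<n. v $ m * (\<Prod>k<m. q ^ i - q ^ k * \<epsilon>)) = (W *\<^sub>v v) $ i"
        using i v(1) n W
        by (auto simp: W_def scalar_prod_def R_def qnewton_def lessThan_atLeast0 mult.commute
            intro!: sum.cong)
      then show ?thesis using i n v(3) by simp
    qed
    then have "v $ m = 0" if "m < n" for m
      using newton_values_independent[OF primitive_root_inj[OF prim], of "\<lambda>m. v $ m" "\<lambda>k. q ^ k * \<epsilon>"]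
        that by blast
    then have "v = 0\<^sub>v (d + 1)" using v(1) n by (intro eq_vecI) auto
    then show False using v(2) by simp
  qed
  have AW: "A * W = W * D"
  proof (rule eq_matI)
    fix i m assume "i < dim_row (W * D)" "m < dim_col (W * D)"
    then have i: "i \<le> d" and m: "m \<le> d" using W D by auto
    have pi: "p i \<le> d" using i by (auto simp: p_def)
    have "(A * W) $$ (i, m) = (\<Sum>j = 0..d. A $$ (i, j) * R m (q ^ j))"
      using i m A W
      by (auto simp: scalar_prod_def W_def atLeastLessThanSuc_atLeastAtMost intro!: sum.cong)
    also have "\<dots> = (\<Sum>j = 0..d. (if j = i then \<epsilon> / q ^ i * R m (q ^ j) else 0)
        + (if j = p i then (1 - \<epsilon> / q ^ i) * R m (q ^ j) else 0))"
      using i by (intro sum.cong) (auto simp: A_ix algebra_simps)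
    also have "\<dots> = \<epsilon> / q ^ i * R m (q ^ i) + (1 - \<epsilon> / q ^ i) * R m (q ^ p i)"
      using i pi by (simp add: sum.distrib)
    also have "\<dots> = R m (q ^ i) * inverse q ^ m"
    proof -
      \<comment> \<open>The shift identity at \<open>y = q ^ p i\<close>, with the common factor
        \<open>R m (q ^ i)\<close> split off; row 0 needs no separate case thanks to
        \<open>q_p\<close>.\<close>
      have "(q ^ i - \<epsilon>) * (q ^ m * R m (q ^ p i)) = (q ^ i - q ^ m * \<epsilon>) * R m (q ^ i)"
        using qnewton_shift[of q "q ^ p i" \<epsilon> m] by (simp add: q_p R_def qnewton_Suc)
      then show ?thesis using q0 by (simp add: field_simps)
    qed
    also have "\<dots> = (W * D) $$ (i, m)"
      unfolding D_def mat_diag_mult_right[OF W] using i m by (simp add: W_def)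
    finally show "(A * W) $$ (i, m) = (W * D) $$ (i, m)" .
  qed (use A W D in auto)
  have AsW: "As * W = W * Xs"
  proof (rule eq_matI)
    fix i m assume "i < dim_row (W * Xs)" "m < dim_col (W * Xs)"
    then have i: "i \<le> d" and m: "m \<le> d" using W Xs by auto
    have sm: "s m \<le> d" using m by (auto simp: s_def)
    have rec: "q ^ i * R m (q ^ i) = R m (q ^ i) * (q ^ m * \<epsilon>) + R (Suc m) (q ^ i)"
      by (simp add: R_def qnewton_Suc algebra_simps)
    have "(W * Xs) $$ (i, m) = (\<Sum>k = 0..d. R k (q ^ i) * Xs $$ (k, m))"
      using i m W Xs
      by (auto simp: scalar_prod_def W_def atLeastLessThanSuc_atLeastAtMost intro!: sum.cong)
    also have "\<dots> = (\<Sum>k = 0..d. (if k = m then R k (q ^ i) * (q ^ m * \<epsilon>) else 0)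
        + (if k = s m then R k (q ^ i) * (if m = d then c else 1) else 0))"
      using m by (intro sum.cong) (auto simp: Xs_def algebra_simps)
    also have "\<dots> = R m (q ^ i) * (q ^ m * \<epsilon>) + R (s m) (q ^ i) * (if m = d then c else 1)"
      using m sm by (simp add: sum.distrib)
    \<comment> \<open>For \<open>m = d\<close> the left side is \<open>R 0\<close> times
      \<open>c\<close>, and \<open>Suc d = n\<close>, so \<open>R_n\<close> closes the
      cycle.\<close>
    also have "R (s m) (q ^ i) * (if m = d then c else 1) = R (Suc m) (q ^ i)"
      using R_n[of i] n by (auto simp: s_def R_def)
    also have "R m (q ^ i) * (q ^ m * \<epsilon>) + R (Suc m) (q ^ i) = (As * W) $$ (i, m)"
      unfolding As_diag mat_diag_mult_left[OF W] using i m by (simp add: W_def rec)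
    finally show "(As * W) $$ (i, m) = (W * Xs) $$ (i, m)" ..
  qed (use As W Xs in auto)
  have bid_A: "circular_bidiagonal d A"
    using d A pow_ne[of 0] unfolding circular_bidiagonal_def
    by (auto simp: A_ix p_def q0 pow_ne pow_ne[symmetric] split: if_splits)
  have bid_Xs: "circular_bidiagonal d Xs"
    using d Xs c0 unfolding circular_bidiagonal_def
    by (auto simp: Xs_def s_def split: if_splits)
  have diag: "diagonal_mat D" "diagonal_mat As"
    by (simp_all add: diagonal_mat_def D_def As_diag mat_diag_def)
  interpret vec_space "TYPE('a)" "d + 1" .
  \<comment> \<open>The standard basis, written as columns of the identity, serves the first
    condition; the columns of \<open>W\<close> serve the second.\<close>
  have std: "indexed_basis V d (col (1\<^sub>m (d + 1)))"
    "represents_wrt V d (col (1\<^sub>m (d + 1))) A (\<lambda>x. A *\<^sub>v x)"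
    "represents_wrt V d (col (1\<^sub>m (d + 1))) As (\<lambda>x. As *\<^sub>v x)"
    by (intro indexed_basis_col represents_wrt_col; use A As in simp)+
  have "circular_bidiagonal_pair V d (\<lambda>x. A *\<^sub>v x) (\<lambda>x. As *\<^sub>v x)"
    unfolding circular_bidiagonal_pair_def
    using vec_vs fin_dim dim_is_n linear_map_mult_mat_vec[OF A] linear_map_mult_mat_vec[OF As]
      std bid_A diag indexed_basis_col[OF W det] represents_wrt_col[OF W D A AW]
      represents_wrt_col[OF W Xs As AsW] bid_Xs
    by blast
  moreover have "A ^\<^sub>m n = 1\<^sub>m (d + 1)"
  proof (rule pow_mat_eq_one_of_intertwine[OF A W D AW det])
    have "(inverse q ^ m) ^ n = 1" for m
      using qn by (metis inverse_1 power_inverse power_mult power_one mult.commute)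
    then show "D ^\<^sub>m n = 1\<^sub>m (d + 1)"
      by (simp add: D_def pow_mat_diag)
  qed
  moreover have "As ^\<^sub>m n = 1\<^sub>m (d + 1)"
  proof -
    have "(q ^ m) ^ n = 1" for m
      using qn by (metis power_mult power_one mult.commute)
    then show ?thesis by (simp add: As_diag pow_mat_diag)
  qed
  moreover have "(1 / (q - 1)) \<cdot>\<^sub>m (q \<cdot>\<^sub>m (A * As) - As * A) = \<epsilon> \<cdot>\<^sub>m 1\<^sub>m (d + 1)"
  proof (rule eq_matI)
    fix i j assume "i < dim_row (\<epsilon> \<cdot>\<^sub>m 1\<^sub>m (d + 1))" "j < dim_col (\<epsilon> \<cdot>\<^sub>m 1\<^sub>m (d + 1))"
    then have i: "i \<le> d" and j: "j \<le> d" by auto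
    \<comment> \<open>The factor \<open>q * q ^ j - q ^ i\<close> vanishes at
      \<open>j = p i\<close>, so the off-diagonal part of \<open>A\<close> drops out.\<close>
    have "((1 / (q - 1)) \<cdot>\<^sub>m (q \<cdot>\<^sub>m (A * As) - As * A)) $$ (i, j)
        = A $$ (i, j) * (q * q ^ j - q ^ i) / (q - 1)"
      unfolding As_diag mat_diag_mult_left[OF A] mat_diag_mult_right[OF A]
      using i j by (simp add: right_diff_distrib diff_divide_distrib ac_simps)
    also have "\<dots> = (if i = j then \<epsilon> else 0)"
    proof -
      have "p i \<noteq> i" using d by (auto simp: p_def)
      moreover have "\<epsilon> / q ^ i * (q * q ^ i - q ^ i) / (q - 1) = \<epsilon>"
        using q0 q1 by (simp add: field_simps)
      ultimately show ?thesis
        using i j q1 by (auto simp: A_ix q_p)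
    qed
    finally show "((1 / (q - 1)) \<cdot>\<^sub>m (q \<cdot>\<^sub>m (A * As) - As * A)) $$ (i, j)
        = (\<epsilon> \<cdot>\<^sub>m 1\<^sub>m (d + 1)) $$ (i, j)"
      using i j by simp
  qed (use A As in auto)
  ultimately show ?thesis by blast
qed

end
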